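(* For $D\in\{-11,-19,-43,-67,-163\}$ let $\widetilde P_D(X)\in\mathbb Z[X]$ be the cubic polynomials $$\begin{aligned} \widetilde P_{-11}(X)={}&290521X^3-420048X^2+531200X+4096,\\ \widetilde P_{-19}(X)={}&191850201X^3-11442384X^2+14162688X+4096,\\ \widetilde P_{-43}(X)={}&191103722496729X^3-11446268112X^2+14155782912X+4096,\\ \widetilde P_{-67}(X)={}&5289852925222272729X^3-1904373500112X^2+2355167238912X+4096,\\ \widetilde P_{-163}(X)={}&16827610604518993301932059648729X^3-3396577776039932112X^2\\&+4200598602252294912X+4096, \end{aligned}$$ let $a_D$ be the leading coefficient of $\widetilde P_D$, and let $P_D^{\rm mon}=a_D^{-1}\widetilde P_D$. Then for each of these five $D$, $$\frac{\operatorname{disc}(P_D^{\rm mon})}{D}\in(\mathbb Q^\times)^2,$$ equivalently $\operatorname{disc}(P_D^{\rm mon})=D\,r_D^2$ with $r_D\in\mathbb Q^\times$ (so the quadratic resolvent field of the cubic is $\mathbb Q(\sqrt D)$). More precisely, one may take, in lowest terms, $$\begin{aligned} r_{-11}&=\frac{2201485312}{1722499009},\\ r_{-19}&=\frac{211288064}{23085974187},\\ r_{-43}&=\frac{90898432000000}{467483085772005891483},\\ r_{-67}&=\frac{838712123392000000}{11554551952877987779657554693},\\ r_{-163}&=\frac{889345562545495347888128000000}{45519895289170469819991986914645772910060302515527}. \end{aligned}$$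
   Context: $\operatorname{disc}$ denotes the polynomial discriminant. The quadratic resolvent field of a cubic polynomial $P\in\mathbb Q[X]$ with nonzero discriminant is $\mathbb Q(\sqrt{\operatorname{disc}P})$. *)

theory Defs
  imports
    "HOL-Algebra.Generated_Fields"
    "HOL-Algebra.Algebraic_Closure_Type"
    "Subresultants.Resultant_Prelim"
begin

text \<open>
  For \<open>P\<close> of degree \<open>n \<ge> 1\<close> with leading coefficient \<open>a\<close>, this is the usual
  \<open>disc P = (-1)^(n(n-1)/2) a^(-1) Res(P, P')\<close>. Characteristic zero guarantees
  \<open>degree (pderiv P) = n - 1\<close>, so that the Sylvester matrix has the expected size \<open>2n - 1\<close>.
\<close>

definition discriminant :: "'a :: field_char_0 poly \<Rightarrow> 'a" where
  "discriminant P =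
     (-1) ^ (degree P * (degree P - 1) div 2) * resultant P (pderiv P) / lead_coeff P"

text \<open>
  The field \<open>\<rat>(\<surd>d)\<close> as a subfield of the complex numbers. A generated subfield contains \<open>1\<close>,
  hence all of \<open>\<rat>\<close>; the choice of the square root is immaterial.
\<close>

definition rat_adjoin_sqrt :: "rat \<Rightarrow> complex set" where
  "rat_adjoin_sqrt d = generate_field ring_of_type_algebra {csqrt (of_rat d)}"

definition quadratic_resolvent_field :: "rat poly \<Rightarrow> complex set" where
  "quadratic_resolvent_field P = rat_adjoin_sqrt (discriminant P)"

definition nonzero_rat_squares :: "rat set" where
  "nonzero_rat_squares = {q\<^sup>2 | q. q \<noteq> 0}"

text \<open>
  Coefficient lists below start with the constant term. The values for \<open>D\<close> outside
  \<open>{-11, -19, -43, -67, -163}\<close> are irrelevant.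
\<close>

definition P_tilde :: "int \<Rightarrow> int poly" where
  "P_tilde D =
    (if D = -11 then [:4096, 531200, -420048, 290521:]
     else if D = -19 then [:4096, 14162688, -11442384, 191850201:]
     else if D = -43 then [:4096, 14155782912, -11446268112, 191103722496729:]
     else if D = -67 then [:4096, 2355167238912, -1904373500112, 5289852925222272729:]
     else if D = -163 then
       [:4096, 4200598602252294912, -3396577776039932112, 16827610604518993301932059648729:]
     else 0)"

definition P_mon :: "int \<Rightarrow> rat poly" where
  "P_mon D =
     smult (inverse (of_int (lead_coeff (P_tilde D)))) (map_poly of_int (P_tilde D))"

definition r_num :: "int \<Rightarrow> int" where
  "r_num D =
    (if D = -11 then 2201485312
     else if D = -19 then 211288064
     else if D = -43 then 90898432000000
     else if D = -67 then 838712123392000000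
     else if D = -163 then 889345562545495347888128000000
     else 0)"

definition r_den :: "int \<Rightarrow> int" where
  "r_den D =
    (if D = -11 then 1722499009
     else if D = -19 then 23085974187
     else if D = -43 then 467483085772005891483
     else if D = -67 then 11554551952877987779657554693
     else if D = -163 then 45519895289170469819991986914645772910060302515527
     else 1)"

end

theory Submission
  imports Defs "Subresultants.Subresultant"
begin

text \<open>
  The five cubics are members of one family. Let \<open>j\<close> be the \<open>j\<close>-invariant of the imaginary
  quadratic order of discriminant \<open>D\<close>, that is \<open>-32\<^sup>3\<close>, \<open>-96\<^sup>3\<close>, \<open>-960\<^sup>3\<close>, \<open>-5280\<^sup>3\<close>,
  \<open>-640320\<^sup>3\<close> for \<open>D = -11, -19, -43, -67, -163\<close>. Then the cubic attached to \<open>D\<close> is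
  \<open>u\<^sup>2 X\<^sup>3 + (207 j / 16 + 3888) X\<^sup>2 + 16 (432 - j) X + 4096\<close> with \<open>u = (1728 - j) / 64\<close>,
  and its discriminant, as a polynomial in \<open>j\<close>, factors as
  \<open>(j - 1728) (j (2 j + 6750))\<^sup>2\<close> (lemma \<open>discriminant_modular_cubic\<close>).

  So up to squares the discriminant is \<open>j - 1728\<close>. For these \<open>D\<close> this number is \<open>D y\<^sup>2\<close> with an
  integer \<open>y\<close>, for example \<open>-32\<^sup>3 - 1728 = -11 \<cdot> 56\<^sup>2\<close>. Passing to the monic cubic divides the
  discriminant by the fourth power of the leading coefficient \<open>u\<^sup>2\<close>, again a square. Hence
  the discriminant is \<open>D r\<^sup>2\<close> with \<open>r = y j (2 j + 6750) / u\<^sup>4\<close>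
  (lemma \<open>discriminant_P_mon_modular\<close>), and it remains to reduce this fraction for each \<open>D\<close>.

  The two general ingredients are the classical formula for the discriminant of a cubic, read
  off from the \<open>5 \<times> 5\<close> Sylvester determinant (lemma \<open>discriminant_cubic\<close>), and the fact that
  multiplying \<open>d\<close> by a nonzero rational square does not change \<open>\<rat>(\<surd>d)\<close>
  (lemma \<open>rat_adjoin_sqrt_mult_square\<close>).
\<close>

section \<open>The discriminant of a cubic\<close>

text \<open>
  Laplace expansion along the first row. With the matrix given by its list of rows, every minor is
  again an explicit list of rows, so rewriting evaluates concrete determinants and drops the terms
  with a zero entry as it goes.
\<close>

lemma det_mat_of_rows_list_Cons:
  fixes r :: "'a :: comm_ring_1 list"
  assumes "length rs = n" "length r = Suc n" "\<forall>r' \<in> set rs. length r' = Suc n"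
  shows "det (mat_of_rows_list (Suc n) (r # rs)) =
    (\<Sum>j<Suc n. r ! j * ((-1) ^ j *
       det (mat_of_rows_list n (map (\<lambda>r'. take j r' @ drop (Suc j) r') rs))))"
proof -
  let ?A = "mat_of_rows_list (Suc n) (r # rs)"
  have minor: "mat_delete ?A 0 j =
      mat_of_rows_list n (map (\<lambda>r'. take j r' @ drop (Suc j) r') rs)" if "j < Suc n" for j
    using that assms
    by (intro eq_matI) (auto simp: mat_delete_def mat_of_rows_list_def nth_append)
  have "det ?A = (\<Sum>j<Suc n. ?A $$ (0, j) * cofactor ?A 0 j)"
    using assms(1) by (intro laplace_expansion_row) (auto simp: mat_of_rows_list_def)
  also have "\<dots> = (\<Sum>j<Suc n. r ! j * ((-1) ^ j *
      det (mat_of_rows_list n (map (\<lambda>r'. take j r' @ drop (Suc j) r') rs))))"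
  proof (rule sum.cong[OF refl])
    fix j
    assume "j \<in> {..<Suc n}"
    then have "?A $$ (0, j) = r ! j"
      and "cofactor ?A 0 j = (-1) ^ j *
        det (mat_of_rows_list n (map (\<lambda>r'. take j r' @ drop (Suc j) r') rs))"
      by (simp_all add: cofactor_def minor) (simp add: mat_of_rows_list_def)
    then show "?A $$ (0, j) * cofactor ?A 0 j = r ! j * ((-1) ^ j *
        det (mat_of_rows_list n (map (\<lambda>r'. take j r' @ drop (Suc j) r') rs)))"
      by simp
  qed
  finally show ?thesis .
qed

lemma det_mat_of_rows_list_Nil: "det (mat_of_rows_list 0 []) = 1"
  by (simp add: mat_of_rows_list_def det_dim_zero[OF mat_carrier])

lemma discriminant_cubic:
  fixes a b c d :: "'a :: field_char_0"
  assumes "a \<noteq> 0"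
  shows "discriminant [:d, c, b, a:] =
    b\<^sup>2 * c\<^sup>2 - 4 * a * c ^ 3 - 4 * b ^ 3 * d + 18 * a * b * c * d - 27 * a\<^sup>2 * d\<^sup>2"
proof -
  have deriv: "pderiv [:d, c, b, a:] = [:c, 2 * b, 3 * a:]"
    by (simp add: pderiv_pCons)
  have deg: "degree [:d, c, b, a:] = 3" "degree [:c, 2 * b, 3 * a:] = 2"
    using assms by simp_all
  have "sylvester_mat [:d, c, b, a:] [:c, 2 * b, 3 * a:] = mat_of_rows_list 5
      [[a, b, c, d, 0],
       [0, a, b, c, d],
       [3 * a, 2 * b, c, 0, 0],
       [0, 3 * a, 2 * b, c, 0],
       [0, 0, 3 * a, 2 * b, c]]" (is "_ = mat_of_rows_list 5 ?rows")
    unfolding sylvester_mat_def deg sylvester_mat_sub_def mat_of_rows_list_def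
    by (intro eq_matI) (auto simp: eval_nat_numeral less_Suc_eq)
  then have "resultant [:d, c, b, a:] [:c, 2 * b, 3 * a:] = det (mat_of_rows_list 5 ?rows)"
    by (simp add: resultant_def)
  also have "\<dots> =
      - a * (b\<^sup>2 * c\<^sup>2 - 4 * a * c ^ 3 - 4 * b ^ 3 * d + 18 * a * b * c * d - 27 * a\<^sup>2 * d\<^sup>2)"
    by (simp add: eval_nat_numeral det_mat_of_rows_list_Cons det_mat_of_rows_list_Nil lessThan_Suc)
       (simp add: algebra_simps)
  finally have resultant: "resultant [:d, c, b, a:] [:c, 2 * b, 3 * a:] = \<dots>" .
  have "coeff [:d, c, b, a:] 3 = a"
    by (simp add: eval_nat_numeral)
  then show ?thesis
    using assms unfolding discriminant_def deriv deg resultant by simp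
qed

text \<open>
  \<open>P\<close> and its derivative are both scaled by \<open>k\<close>, which gives \<open>k\<close> to the power
  \<open>(n - 1) + n\<close> in the resultant for \<open>n = degree P\<close>; the leading coefficient takes one factor away.
\<close>

lemma discriminant_smult:
  assumes "k \<noteq> 0" "degree P > 0"
  shows "discriminant (smult k P) = k ^ (2 * (degree P - 1)) * discriminant P"
proof -
  obtain n where n: "degree P = Suc n"
    using assms(2) gr0_implies_Suc by blast
  have "resultant (smult k P) (pderiv (smult k P)) =
      k ^ degree (pderiv P) * (k ^ degree P * resultant P (pderiv P))"
    using assms(1) by (simp add: pderiv_smult resultant_smult_left resultant_smult_right)
  also have "\<dots> = k * k ^ (2 * n) * resultant P (pderiv P)"
    by (simp add: degree_pderiv n mult_2 power_add)
  finally show ?thesis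
    using assms(1) by (simp add: discriminant_def n)
qed

section \<open>Rational square factors and quadratic fields\<close>

lemma type_algebra_minus: "a_inv (ring_of_type_algebra :: 'a :: field ring) x = - x"
proof -
  interpret R: field "ring_of_type_algebra :: 'a ring"
    by (rule field_from_type_algebra)
  show ?thesis
    by (rule R.minus_equality) (simp_all add: ring_of_type_algebra_def)
qed

lemma type_algebra_inverse:
  assumes "x \<noteq> 0"
  shows "m_inv (ring_of_type_algebra :: 'a :: field ring) x = inverse x"
proof -
  interpret R: field "ring_of_type_algebra :: 'a ring"
    by (rule field_from_type_algebra)
  show ?thesis
    using assms by (intro R.inv_char) (simp_all add: ring_of_type_algebra_def)
qed

text \<open>A generated field contains \<open>1\<close>, hence the prime field.\<close>

lemma of_rat_mult_in_generate_field:
  fixes H :: "'a :: field_char_0 set"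
  assumes x: "x \<in> generate_field ring_of_type_algebra H"
  shows "of_rat q * x \<in> generate_field ring_of_type_algebra H"
proof -
  let ?F = "generate_field ring_of_type_algebra H"
  have one: "1 \<in> ?F"
    using generate_field.one[of ring_of_type_algebra H] by (simp add: ring_of_type_algebra_def)
  have add: "u + v \<in> ?F" if "u \<in> ?F" "v \<in> ?F" for u v
    using generate_field.eng_add[OF that] by (simp add: ring_of_type_algebra_def)
  have mult: "u * v \<in> ?F" if "u \<in> ?F" "v \<in> ?F" for u v
    using generate_field.eng_mult[OF that] by (simp add: ring_of_type_algebra_def)
  have minus: "- u \<in> ?F" if "u \<in> ?F" for u
    using generate_field.a_inv[OF that] by (simp add: type_algebra_minus)
  have inverse: "inverse u \<in> ?F" if "u \<in> ?F" "u \<noteq> 0" for u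
    using generate_field.m_inv[OF that(1)] that(2)
    by (simp add: type_algebra_inverse) (simp add: ring_of_type_algebra_def)
  have zero: "0 \<in> ?F"
    using add[OF one minus[OF one]] by simp
  have nat: "of_nat n \<in> ?F" for n
    by (induction n) (simp_all add: zero one add)
  have int: "of_int k \<in> ?F" for k
    by (cases k rule: int_cases2) (simp_all add: nat minus)
  obtain m n where q: "q = Rat.Fract m n" "n > 0"
    by (cases q rule: Rat_cases) auto
  have "of_int m * inverse (of_int n) * x \<in> ?F"
    using \<open>n > 0\<close> by (intro mult inverse int x) simp
  then show ?thesis
    using q by (simp add: of_rat_rat divide_inverse)
qed

lemma generate_field_rat_multiple_subset:
  fixes x :: "'a :: field_char_0"
  shows "generate_field ring_of_type_algebra {of_rat q * x} \<subseteq> generate_field ring_of_type_algebra {x}"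
proof -
  interpret R: field "ring_of_type_algebra :: 'a ring"
    by (rule field_from_type_algebra)
  have carrier: "{y} \<subseteq> carrier ring_of_type_algebra" for y :: 'a
    by (simp add: ring_of_type_algebra_def)
  have "of_rat q * x \<in> generate_field ring_of_type_algebra {x}"
    by (intro of_rat_mult_in_generate_field generate_field.incl) simp
  then show ?thesis
    by (intro R.generate_field_min_subfield1 R.generate_field_is_subfield carrier) auto
qed

lemma generate_field_rat_multiple:
  fixes x :: "'a :: field_char_0"
  assumes "q \<noteq> 0"
  shows "generate_field ring_of_type_algebra {of_rat q * x} = generate_field ring_of_type_algebra {x}"
proof (rule antisym[OF generate_field_rat_multiple_subset])
  have "of_rat (inverse q) * (of_rat q * x) = x"
    using assms by (simp add: of_rat_inverse)
  then show "generate_field ring_of_type_algebra {x} \<subseteq>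
      generate_field ring_of_type_algebra {of_rat q * x}"
    by (metis generate_field_rat_multiple_subset)
qed

text \<open>
  The principal square root is not multiplicative, so the root of \<open>d r\<^sup>2\<close> is only known to be one
  of \<open>r \<surd>d\<close> and \<open>-r \<surd>d\<close>; both generate the same field as \<open>\<surd>d\<close>.
\<close>

lemma rat_adjoin_sqrt_mult_square:
  assumes "r \<noteq> 0"
  shows "rat_adjoin_sqrt (d * r\<^sup>2) = rat_adjoin_sqrt d"
proof -
  have "(csqrt (of_rat (d * r\<^sup>2)))\<^sup>2 = (of_rat r * csqrt (of_rat d))\<^sup>2"
    by (simp only: power_mult_distrib power2_csqrt of_rat_mult of_rat_power mult.commute)
  then have "csqrt (of_rat (d * r\<^sup>2)) = of_rat r * csqrt (of_rat d) \<or>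
      csqrt (of_rat (d * r\<^sup>2)) = of_rat (- r) * csqrt (of_rat d)"
    by (simp only: power2_eq_iff of_rat_minus mult_minus_left)
  then show ?thesis
    unfolding rat_adjoin_sqrt_def
  proof (elim disjE ssubst)
    show "generate_field ring_of_type_algebra {of_rat r * csqrt (of_rat d)} =
        generate_field ring_of_type_algebra {csqrt (of_rat d)}"
      using assms by (rule generate_field_rat_multiple)
    show "generate_field ring_of_type_algebra {of_rat (- r) * csqrt (of_rat d)} =
        generate_field ring_of_type_algebra {csqrt (of_rat d)}"
      using assms by (intro generate_field_rat_multiple) simp
  qed
qed

section \<open>The family of cubics\<close>

text \<open>
  The formulas in \<open>j\<close> interpolate the given coefficients: over the five values of \<open>j\<close> the two
  middle coefficients are affine functions of \<open>j\<close>, and the leading coefficient is the square of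
  an affine function.
\<close>

definition modular_cubic :: "'a :: field_char_0 \<Rightarrow> 'a poly" where
  "modular_cubic j = [:4096, 16 * (432 - j), 207 * j / 16 + 3888, ((1728 - j) / 64)\<^sup>2:]"

lemma degree_modular_cubic: "j \<noteq> 1728 \<Longrightarrow> degree (modular_cubic j) = 3"
  by (simp add: modular_cubic_def)

lemma lead_coeff_modular_cubic: "j \<noteq> 1728 \<Longrightarrow> lead_coeff (modular_cubic j) = ((1728 - j) / 64)\<^sup>2"
  by (simp add: modular_cubic_def)

lemma discriminant_modular_cubic:
  assumes "j \<noteq> 1728"
  shows "discriminant (modular_cubic j) = (j - 1728) * (j * (2 * j + 6750))\<^sup>2"
proof -
  \<comment> \<open>In terms of \<open>u\<close> all coefficients are polynomials over the integers.\<close>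
  define u where "u = (1728 - j) / 64"
  have j: "j = 1728 - 64 * u"
    using u_def by (simp add: field_simps)
  have "u \<noteq> 0"
    using assms by (simp add: u_def)
  have "modular_cubic j = [:4096, 1024 * u - 20736, 26244 - 828 * u, u\<^sup>2:]"
    by (simp add: modular_cubic_def j field_simps)
  moreover have "discriminant [:4096, 1024 * u - 20736, 26244 - 828 * u, u\<^sup>2:] =
      (j - 1728) * (j * (2 * j + 6750))\<^sup>2"
    using \<open>u \<noteq> 0\<close> by (subst discriminant_cubic) (simp_all add: j algebra_simps eval_nat_numeral)
  ultimately show ?thesis
    by simp
qed

lemma discriminant_P_mon_modular:
  fixes j y :: rat
  assumes P: "map_poly of_int (P_tilde D) = modular_cubic j"
    and j: "j - 1728 = of_int D * y\<^sup>2" "j \<noteq> 1728"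
  shows "discriminant (P_mon D) = of_int D * (y * j * (2 * j + 6750) / ((1728 - j) / 64) ^ 4)\<^sup>2"
proof -
  define u where "u = (1728 - j) / 64"
  define e where "e = j * (2 * j + 6750)"
  have "P_mon D = smult (inverse (u\<^sup>2)) (modular_cubic j)"
    using lead_coeff_modular_cubic[OF j(2)] unfolding P_mon_def P[symmetric] u_def by simp
  then have "discriminant (P_mon D) = inverse (u\<^sup>2) ^ 4 * (of_int D * y\<^sup>2 * e\<^sup>2)"
    using j(2)
    by (simp add: discriminant_smult degree_modular_cubic discriminant_modular_cubic
        u_def e_def flip: j(1))
  also have "\<dots> = of_int D * (y * e / u ^ 4)\<^sup>2"
    by (simp add: power_mult_distrib divide_inverse power_inverse flip: power_mult)
  finally show ?thesis
    by (simp add: e_def u_def mult.assoc)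
qed

lemma discriminant_P_mon:
  assumes "D \<in> {-11, -19, -43, -67, -163}"
  shows "discriminant (P_mon D) = of_int D * (of_int (r_num D) / of_int (r_den D))\<^sup>2"
proof -
  have from_j_invariant: ?thesis
    if "map_poly of_int (P_tilde D) = modular_cubic j" "j - 1728 = of_int D * y\<^sup>2" "j \<noteq> 1728"
      and "of_int (r_num D) / of_int (r_den D) = y * j * (2 * j + 6750) / ((1728 - j) / 64) ^ 4"
    for j y :: rat
    unfolding that(4) using that(1-3) by (rule discriminant_P_mon_modular)
  note defs = P_tilde_def modular_cubic_def map_poly_pCons r_num_def r_den_def
  consider "D = -11" | "D = -19" | "D = -43" | "D = -67" | "D = -163"
    using assms by auto
  \<comment> \<open>In each case \<open>j\<close> is the \<open>j\<close>-invariant of discriminant \<open>D\<close>, and \<open>y\<close> the root of \<open>(j - 1728) / D\<close>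
    whose sign makes \<open>r\<close> positive: both \<open>j\<close> and \<open>2 j + 6750\<close> are negative, so \<open>y > 0\<close>.\<close>
  then show ?thesis
  proof cases
    case 1
    then show ?thesis
      by (intro from_j_invariant[of "- (32 ^ 3)" 56]) (simp_all add: defs)
  next
    case 2
    then show ?thesis
      by (intro from_j_invariant[of "- (96 ^ 3)" 216]) (simp_all add: defs)
  next
    case 3
    then show ?thesis
      by (intro from_j_invariant[of "- (960 ^ 3)" 4536]) (simp_all add: defs)
  next
    case 4
    then show ?thesis
      by (intro from_j_invariant[of "- (5280 ^ 3)" 46872]) (simp_all add: defs)
  next
    case 5
    then show ?thesis
      by (intro from_j_invariant[of "- (640320 ^ 3)" 40133016]) (simp_all add: defs)
  qed
qed

lemma r_lowest_terms:
  assumes "D \<in> {-11, -19, -43, -67, -163}"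
  shows "r_num D \<noteq> 0" "r_den D > 0" "coprime (r_num D) (r_den D)"
  using assms by (elim insertE emptyE; simp only:; code_simp)+

theorem proposition3:
  fixes D :: int
  assumes "D \<in> {-11, -19, -43, -67, -163}"
  shows "discriminant (P_mon D) / of_int D \<in> nonzero_rat_squares
    \<and> (\<exists>r :: rat. r \<noteq> 0 \<and> discriminant (P_mon D) = of_int D * r\<^sup>2)
    \<and> quadratic_resolvent_field (P_mon D) = rat_adjoin_sqrt (of_int D)
    \<and> discriminant (P_mon D) = of_int D * (of_int (r_num D) / of_int (r_den D))\<^sup>2
    \<and> r_num D \<noteq> 0 \<and> r_den D > 0 \<and> coprime (r_num D) (r_den D)"
proof -
  define r :: rat where "r = of_int (r_num D) / of_int (r_den D)"
  have disc: "discriminant (P_mon D) = of_int D * r\<^sup>2"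
    unfolding r_def by (rule discriminant_P_mon[OF assms])
  note lowest = r_lowest_terms[OF assms]
  have "r \<noteq> 0"
    using lowest(1,2) by (simp add: r_def)
  moreover have "D \<noteq> 0"
    using assms by auto
  ultimately have "discriminant (P_mon D) / of_int D \<in> nonzero_rat_squares"
    unfolding nonzero_rat_squares_def disc by auto
  moreover have "quadratic_resolvent_field (P_mon D) = rat_adjoin_sqrt (of_int D)"
    unfolding quadratic_resolvent_field_def disc
    by (rule rat_adjoin_sqrt_mult_square[OF \<open>r \<noteq> 0\<close>])
  ultimately show ?thesis
    using disc \<open>r \<noteq> 0\<close> lowest unfolding r_def by blast
qed

end
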